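(* For every integer $n\ge 2$, the cocktail party graph $CP_n$ on $2n$ vertices is a convex-round permutation graph with $\chi(CP_n)+2\le \chi_{\mathrm{o}}(CP_n)$.
   Context: $CP_n$ is the graph obtained from the complete graph $K_{2n}$ on vertex set $\{0,\dots,2n-1\}$ by removing the perfect matching $\{\{2i,2i+1\} : i\in\{0,\dots,n-1\}\}$. A graph is convex-round if its vertices have a circular ordering such that the (open) neighborhood of every vertex is an interval of the circular ordering. A permutation graph is an intersection graph of segments having their two endpoints on two parallel lines, one on each (equivalently, the comparability graph of a poset of dimension at most two). $\chi$ is the chromatic number. A proper odd coloring is a proper vertex coloring in which for every non-isolated vertex some color appears an odd number of times in its open neighborhood; $\chi_{\mathrm{o}}$ is the least number of colors in such a coloring. *)

theory Defs
  imports "HOL-Analysis.Analysis" "Graph_Theory.Pair_Digraph"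
begin

text \<open>
  A finite simple graph is a digraph \<open>G\<close> satisfying \<^locale>\<open>pair_graph\<close>
  (finite, symmetric, loop-free); an edge \<open>uv\<close> is represented by the two arcs
  \<open>(u, v)\<close> and \<open>(v, u)\<close>.
\<close>

definition nbhd :: "'a pair_pre_digraph \<Rightarrow> 'a \<Rightarrow> 'a set" where
  "nbhd G v = {u. (v, u) \<in> parcs G}"

definition cocktail_party :: "nat \<Rightarrow> nat pair_pre_digraph" where
  "cocktail_party n = \<lparr> pverts = {0..<2 * n},
     parcs = {(u, v). u \<in> {0..<2 * n} \<and> v \<in> {0..<2 * n} \<and> u \<noteq> v}
       - {(u, v). \<exists>i<n. {u, v} = {2 * i, 2 * i + 1}} \<rparr>"


text \<open>
  A circular ordering is given by a list enumerating the vertices, read up to rotation;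
  its intervals are the (possibly empty or full) initial pieces of the rotations of the list.
\<close>

definition circular_interval :: "'a list \<Rightarrow> 'a set \<Rightarrow> bool" where
  "circular_interval xs I \<longleftrightarrow> (\<exists>k l. I = set (take l (rotate k xs)))"

definition convex_round :: "'a pair_pre_digraph \<Rightarrow> bool" where
  "convex_round G \<longleftrightarrow> pair_graph G \<and>
     (\<exists>xs. distinct xs \<and> set xs = pverts G \<and>
        (\<forall>v\<in>pverts G. circular_interval xs (nbhd G v)))"


text \<open>
  The two lines are disjoint, so parallel and distinct: \<open>d\<close> is their common direction.
  The segment of \<open>v\<close> joins \<open>a v\<close> on the first line to \<open>b v\<close> on the second.
\<close>

definition permutation_graph :: "'a pair_pre_digraph \<Rightarrow> bool" where
  "permutation_graph G \<longleftrightarrow> pair_graph G \<and>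
     (\<exists>(p :: real \<times> real) q d a b.
        d \<noteq> 0 \<and>
        range (\<lambda>t. p + t *\<^sub>R d) \<inter> range (\<lambda>t. q + t *\<^sub>R d) = {} \<and>
        (\<forall>v\<in>pverts G. a v \<in> range (\<lambda>t. p + t *\<^sub>R d) \<and> b v \<in> range (\<lambda>t. q + t *\<^sub>R d)) \<and>
        (\<forall>u\<in>pverts G. \<forall>v\<in>pverts G. u \<noteq> v \<longrightarrow>
           ((u, v) \<in> parcs G \<longleftrightarrow> closed_segment (a u) (b u) \<inter> closed_segment (a v) (b v) \<noteq> {})))"


definition proper_coloring :: "'a pair_pre_digraph \<Rightarrow> ('a \<Rightarrow> 'c) \<Rightarrow> bool" where
  "proper_coloring G c \<longleftrightarrow> (\<forall>(u, v)\<in>parcs G. c u \<noteq> c v)"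

definition proper_odd_coloring :: "'a pair_pre_digraph \<Rightarrow> ('a \<Rightarrow> 'c) \<Rightarrow> bool" where
  "proper_odd_coloring G c \<longleftrightarrow> proper_coloring G c \<and>
     (\<forall>v\<in>pverts G. nbhd G v \<noteq> {} \<longrightarrow> (\<exists>x. odd (card {u \<in> nbhd G v. c u = x})))"

text \<open>
  The minima below are attained for every finite simple graph, because an injective
  coloring is a proper odd coloring (\<open>ex_proper_odd_coloring\<close>).
\<close>

definition chromatic_number :: "'a pair_pre_digraph \<Rightarrow> nat" where
  "chromatic_number G =
     (LEAST k. \<exists>c :: 'a \<Rightarrow> nat. c ` pverts G \<subseteq> {..<k} \<and> proper_coloring G c)"

definition odd_chromatic_number :: "'a pair_pre_digraph \<Rightarrow> nat" where
  "odd_chromatic_number G =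
     (LEAST k. \<exists>c :: 'a \<Rightarrow> nat. c ` pverts G \<subseteq> {..<k} \<and> proper_odd_coloring G c)"

lemma ex_proper_odd_coloring:
  assumes "pair_graph G"
  shows "\<exists>k. \<exists>c :: 'a \<Rightarrow> nat. c ` pverts G \<subseteq> {..<k} \<and> proper_odd_coloring G c"
proof -
  interpret pair_graph G by fact
  obtain c :: "'a \<Rightarrow> nat" and k where c: "c ` pverts G = {i. i < k}" "inj_on c (pverts G)"
    using finite_imp_inj_to_nat_seg[OF pair_finite_verts] by metis
  have proper: "proper_coloring G c"
    unfolding proper_coloring_def
    using c(2) pair_no_loops in_arcsD1 in_arcsD2 by (fastforce dest: inj_onD)
  have "\<exists>x. odd (card {u \<in> nbhd G v. c u = x})" if "w \<in> nbhd G v" for v w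
  proof
    have "{u \<in> nbhd G v. c u = c w} = {w}"
      using that c(2) in_arcsD2 by (auto simp: nbhd_def dest: inj_onD)
    then show "odd (card {u \<in> nbhd G v. c u = c w})" by simp
  qed
  then have "proper_odd_coloring G c"
    using proper unfolding proper_odd_coloring_def by blast
  moreover have "c ` pverts G \<subseteq> {..<k}" using c(1) by auto
  ultimately show ?thesis by blast
qed

end

theory Submission
  imports Defs
begin

text \<open>
  The pairs \<open>{2 * i, 2 * i + 1}\<close> are consecutive in the natural circular order, so deleting one of
  them from it leaves an interval. For the permutation model, list the pairs in increasing order on
  one line and in decreasing order on the other, keeping the order inside each pair.

  A color class of a proper coloring is contained in a pair, so a coloring with \<open>s\<close> bichromatic pairs
  uses \<open>n + s\<close> colors. The neighborhood of a vertex is the union of the other pairs, and a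
  monochromatic pair contributes an even number to every color; hence an odd coloring has a
  bichromatic pair avoiding any given vertex, and so at least two bichromatic pairs.
\<close>

lemma pverts_cocktail_party [simp]: "pverts (cocktail_party n) = {0..<2 * n}"
  by (simp add: cocktail_party_def)

text \<open>Reduces adjacency to comparing pair indices \<open>u div 2\<close> and
  \<open>v div 2\<close>; all later arguments use this form instead of the existential over
  \<open>i\<close>.\<close>

lemma pair_eq_iff_div_2:
  fixes u v n :: nat
  assumes "u < 2 * n" "u \<noteq> v"
  shows "(\<exists>i<n. {u, v} = {2 * i, 2 * i + 1}) \<longleftrightarrow> u div 2 = v div 2"
proof
  assume "\<exists>i<n. {u, v} = {2 * i, 2 * i + 1}"
  then show "u div 2 = v div 2" by (auto simp: doubleton_eq_iff)
next
  assume "u div 2 = v div 2"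
  then have "u = 2 * (u div 2) + u mod 2" "v = 2 * (u div 2) + v mod 2"
    using mult_div_mod_eq[of 2 u] mult_div_mod_eq[of 2 v] by simp_all
  moreover have "u mod 2 = 0 \<or> u mod 2 = 1" "v mod 2 = 0 \<or> v mod 2 = 1"
    by linarith+
  ultimately have "(u = 2 * (u div 2) \<and> v = 2 * (u div 2) + 1) \<or>
      (u = 2 * (u div 2) + 1 \<and> v = 2 * (u div 2))"
    using assms(2) by linarith
  moreover have "u div 2 < n" using assms(1) by linarith
  ultimately show "\<exists>i<n. {u, v} = {2 * i, 2 * i + 1}"
    unfolding doubleton_eq_iff by blast
qed

lemma parcs_cocktail_party:
  "(u, v) \<in> parcs (cocktail_party n) \<longleftrightarrow> u < 2 * n \<and> v < 2 * n \<and> u div 2 \<noteq> v div 2"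
  using pair_eq_iff_div_2[of u n v] by (auto simp: cocktail_party_def)

lemma nbhd_cocktail_party:
  "v < 2 * n \<Longrightarrow> nbhd (cocktail_party n) v = {u. u < 2 * n \<and> u div 2 \<noteq> v div 2}"
  by (auto simp: nbhd_def parcs_cocktail_party)

lemma pair_graph_cocktail_party: "pair_graph (cocktail_party n)"
proof
  have "parcs (cocktail_party n) \<subseteq> {0..<2 * n} \<times> {0..<2 * n}"
    by (auto simp: parcs_cocktail_party)
  then show "finite (parcs (cocktail_party n))"
    by (rule finite_subset) simp
  show "symmetric (with_proj (cocktail_party n))"
    by (auto simp: symmetric_def sym_def parcs_cocktail_party)
qed (auto simp: parcs_cocktail_party)

text \<open>Rotating by \<open>k + 2\<close> moves \<open>k\<close> and \<open>k + 1\<close> to the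
  end of the list, where \<open>take (m - 2)\<close> cuts them off.\<close>

lemma set_take_rotate_upt:
  assumes "k + 2 \<le> m"
  shows "set (take (m - 2) (rotate (k + 2) [0..<m])) = {0..<m} - {k, k + 1}"
proof (cases "k + 2 = m")
  \<comment> \<open>The shift equals the length, so the rotation is the identity;
    \<open>rotate_drop_take\<close> would reduce it to 0 modulo the length.\<close>
  case True
  then show ?thesis by auto
next
  case False
  then have "rotate (k + 2) [0..<m] = [k + 2..<m] @ [0..<k + 2]"
    using assms by (simp add: rotate_drop_take take_upt)
  then show ?thesis using assms by (auto simp: take_upt)
qed

lemma convex_round_cocktail_party: "convex_round (cocktail_party n)"
  unfolding convex_round_def
proof (intro conjI exI[of _ "[0..<2 * n]"] ballI)
  fix v assume "v \<in> pverts (cocktail_party n)"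
  then have v: "v < 2 * n" by simp
  have "nbhd (cocktail_party n) v = {0..<2 * n} - {2 * (v div 2), 2 * (v div 2) + 1}"
    unfolding nbhd_cocktail_party[OF v] by auto
  also have "\<dots> = set (take (2 * n - 2) (rotate (2 * (v div 2) + 2) [0..<2 * n]))"
    using v by (intro set_take_rotate_upt[symmetric]) presburger
  finally show "circular_interval [0..<2 * n] (nbhd (cocktail_party n) v)"
    unfolding circular_interval_def by blast
qed (simp_all add: pair_graph_cocktail_party)

text \<open>A common point has the same height \<open>t\<close> on both segments. The horizontal gap
  at height \<open>t\<close> is affine, running from \<open>x - x'\<close> to \<open>y - y'\<close>,
  so it vanishes on the unit interval iff these do not have the same strict sign.\<close>

lemma segments_between_lines_meet_iff:
  fixes x y x' y' :: real
  assumes "x \<noteq> x'"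
  shows "closed_segment (x, 0::real) (y, 1) \<inter> closed_segment (x', 0) (y', 1) \<noteq> {} \<longleftrightarrow>
    (x - x') * (y - y') \<le> 0" (is "?L \<longleftrightarrow> ?R")
proof
  assume ?L
  then obtain t where t: "0 \<le> t" "t \<le> 1" "(1 - t) * x + t * y = (1 - t) * x' + t * y'"
    by (auto simp: in_segment)
  then have "t * (y - y') = - ((1 - t) * (x - x'))" by (simp add: algebra_simps)
  \<comment> \<open>Multiplying by \<open>x - x'\<close> makes the right side minus a nonnegative
    square, so the sign of the product can be read off once \<open>t\<close> is positive.\<close>
  then have "(x - x') * (t * (y - y')) = - ((1 - t) * (x - x')\<^sup>2)"
    by (simp add: power2_eq_square)
  then have "t * ((x - x') * (y - y')) = - ((1 - t) * (x - x')\<^sup>2)"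
    by (simp add: mult.left_commute)
  moreover have "0 \<le> (1 - t) * (x - x')\<^sup>2" using t by simp
  moreover have "t \<noteq> 0" using t assms by auto
  ultimately show ?R using t(1) by (metis mult_pos_pos not_le order_less_le neg_le_0_iff_le)
next
  assume R: ?R
  \<comment> \<open>The zero of the affine gap
    \<open>(1 - t) * (x - x') + t * (y - y')\<close>.\<close>
  define t where "t = (x - x') / ((x - x') - (y - y'))"
  have ne: "(x - x') - (y - y') \<noteq> 0"
    using R assms by (auto simp: mult_le_0_iff)
  have t: "0 \<le> t" "t \<le> 1"
    using R assms ne unfolding t_def by (auto simp: mult_le_0_iff divide_simps)
  have "t * ((x - x') - (y - y')) = x - x'" using ne by (simp add: t_def)
  then have "(1 - t) * x + t * y = (1 - t) * x' + t * y'" by (simp add: algebra_simps)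
  then have "((1 - t) * x + t * y, t) \<in> closed_segment (x, 0) (y, 1) \<inter> closed_segment (x', 0) (y', 1)"
    using t by (auto simp: in_segment intro!: exI[of _ t])
  then show ?L by blast
qed

lemma permutation_graph_cocktail_party: "permutation_graph (cocktail_party n)"
proof -
  \<comment> \<open>Position on the second line: the term in \<open>v div 2\<close> reverses the
    order of the pairs, the term \<open>v mod 2\<close> keeps the order inside each pair. On the
    first line \<open>v\<close> sits at \<open>v\<close> itself.\<close>
  define \<beta> :: "nat \<Rightarrow> int" where "\<beta> v = int (v mod 2) - 2 * int (v div 2)" for v
  have cross: "(real u - real v) * (real_of_int (\<beta> u) - real_of_int (\<beta> v)) \<le> 0 \<longleftrightarrow>
      u div 2 \<noteq> v div 2" if "u \<noteq> v" for u v
  proof -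
    \<comment> \<open>A larger pair index lowers \<beta> by at least 2, while the parity term can
      make up for only 1.\<close>
    have opposite: "a < b \<and> \<beta> b < \<beta> a" if "a div 2 < b div 2" for a b :: nat
      using that mod_less_divisor[of 2 a] mod_less_divisor[of 2 b]
        div_mult_mod_eq[of a 2] div_mult_mod_eq[of b 2]
      unfolding \<beta>_def by linarith
    have same: "\<beta> u - \<beta> v = int u - int v" if "u div 2 = v div 2"
      using that div_mult_mod_eq[of u 2] div_mult_mod_eq[of v 2] unfolding \<beta>_def by linarith
    show ?thesis
    proof (cases "u div 2 = v div 2")
      case True
      then have "real_of_int (\<beta> u) - real_of_int (\<beta> v) = real u - real v"
        using same by linarith
      then show ?thesis
        using True \<open>u \<noteq> v\<close> by (simp add: mult_le_0_iff)
    next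
      case False
      then have "u < v \<and> \<beta> v < \<beta> u \<or> v < u \<and> \<beta> u < \<beta> v"
        using opposite[of u v] opposite[of v u] by linarith
      then show ?thesis using False by (auto simp: mult_le_0_iff)
    qed
  qed
  show ?thesis
    unfolding permutation_graph_def
  proof (rule conjI[OF pair_graph_cocktail_party], rule exI[of _ "(0, 0)"],
      rule exI[of _ "(0, 1)"], rule exI[of _ "(1, 0)"], rule exI[of _ "\<lambda>v. (real v, 0)"],
      rule exI[of _ "\<lambda>v. (real_of_int (\<beta> v), 1)"], intro conjI ballI impI)
    fix u v assume "u \<in> pverts (cocktail_party n)" "v \<in> pverts (cocktail_party n)" "u \<noteq> v"
    then show "(u, v) \<in> parcs (cocktail_party n) \<longleftrightarrow>
        closed_segment (real u, 0::real) (real_of_int (\<beta> u), 1) \<inter>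
        closed_segment (real v, 0) (real_of_int (\<beta> v), 1) \<noteq> {}"
      by (simp add: segments_between_lines_meet_iff cross parcs_cocktail_party)
  qed (auto simp: zero_prod_def)
qed

text \<open>The pair index is a proper coloring. This upper bound suffices, as it is compared with a
  lower bound of \<open>n + 2\<close> on the odd side.\<close>

lemma chromatic_number_cocktail_party_le: "chromatic_number (cocktail_party n) \<le> n"
  unfolding chromatic_number_def
  by (rule Least_le, rule exI[of _ "\<lambda>v. v div 2"])
    (auto simp: proper_coloring_def parcs_cocktail_party)

text \<open>The even and the odd elements of \<open>A\<close> are both in bijection with the set
  \<open>B\<close> of indices of the pairs that make up \<open>A\<close>.\<close>

lemma even_card_union_of_pairs:
  fixes A :: "nat set"
  assumes "finite A" and "\<And>i. 2 * i \<in> A \<longleftrightarrow> 2 * i + 1 \<in> A"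
  shows "even (card A)"
proof -
  define B where "B = {i. 2 * i \<in> A}"
  have "A = (\<lambda>i. 2 * i) ` B \<union> (\<lambda>i. 2 * i + 1) ` B" (is "_ = ?E \<union> ?O")
  proof
    show "A \<subseteq> ?E \<union> ?O"
    proof
      fix a assume "a \<in> A"
      then show "a \<in> ?E \<union> ?O"
        using assms(2) by (cases "even a") (auto simp: B_def elim!: evenE oddE)
    qed
  qed (auto simp: B_def assms(2)[simplified])
  moreover have "finite B"
    using finite_vimageI[OF assms(1), of "\<lambda>i. 2 * i"] by (simp add: B_def vimage_def inj_def)
  moreover have "?E \<inter> ?O = {}" by (metis (no_types, lifting) disjoint_iff even_mult_iff even_plus_one_iff even_numeral imageE)
  ultimately have "card A = card B + card B"
    by (simp add: card_Un_disjoint card_image inj_on_def)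
  then show ?thesis by simp
qed

lemma proper_odd_coloring_bichromatic_pair:
  assumes "proper_odd_coloring (cocktail_party n) c" and "2 \<le> n" and "j < n"
  shows "\<exists>i<n. i \<noteq> j \<and> c (2 * i) \<noteq> c (2 * i + 1)"
proof -
  define v where "v = 2 * j"
  have nbhd: "nbhd (cocktail_party n) v = {u. u < 2 * n \<and> u div 2 \<noteq> j}"
    using \<open>j < n\<close> by (simp add: nbhd_cocktail_party v_def)
  \<comment> \<open>A vertex outside pair \<open>j\<close>, available since
    \<open>2 \<le> n\<close>: oddness is demanded only at vertices with nonempty
    neighborhood.\<close>
  define w :: nat where "w = (if j = 0 then 2 else 0)"
  have "w \<in> nbhd (cocktail_party n) v" using assms by (simp add: nbhd w_def)
  moreover have "v \<in> pverts (cocktail_party n)" using \<open>j < n\<close> by (simp add: v_def)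
  ultimately obtain x where x: "odd (card {u \<in> nbhd (cocktail_party n) v. c u = x})"
    using assms(1) unfolding proper_odd_coloring_def by blast
  show ?thesis
  proof (rule ccontr)
    assume "\<not> ?thesis"
    \<comment> \<open>With all other pairs monochromatic, each color class in the neighborhood is a
      union of whole pairs. For \<open>i \<ge> n\<close> neither side holds.\<close>
    then have "2 * i \<in> {u \<in> nbhd (cocktail_party n) v. c u = x} \<longleftrightarrow>
        2 * i + 1 \<in> {u \<in> nbhd (cocktail_party n) v. c u = x}" for i
      by (cases "i < n") (auto simp: nbhd)
    then show False using x even_card_union_of_pairs[of "{u \<in> nbhd (cocktail_party n) v. c u = x}"]
      by (simp add: nbhd)
  qed
qed

lemma proper_odd_coloring_cocktail_party_card:
  fixes c :: "nat \<Rightarrow> 'c"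
  assumes "proper_odd_coloring (cocktail_party n) c" and "2 \<le> n"
  shows "n + 2 \<le> card (c ` {0..<2 * n})"
proof -
  \<comment> \<open>Avoiding pair 0 is an arbitrary choice that yields a first bichromatic pair
    \<open>i\<close>; avoiding \<open>i\<close> then yields a second one.\<close>
  obtain i where i: "i < n" "c (2 * i) \<noteq> c (2 * i + 1)"
    using proper_odd_coloring_bichromatic_pair[OF assms, of 0] assms(2) by force
  obtain j where j: "j < n" "j \<noteq> i" "c (2 * j) \<noteq> c (2 * j + 1)"
    using proper_odd_coloring_bichromatic_pair[OF assms i(1)] by blast
  have proper: "c u \<noteq> c v" if "u < 2 * n" "v < 2 * n" "u div 2 \<noteq> v div 2" for u v
    using assms(1) that
    by (auto simp: proper_odd_coloring_def proper_coloring_def parcs_cocktail_party)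
  \<comment> \<open>The even vertex of every pair, together with the odd vertices of the two
    bichromatic pairs: \<open>n + 2\<close> vertices with distinct colors.\<close>
  define S where "S = (\<lambda>k. 2 * k) ` {..<n} \<union> {2 * i + 1, 2 * j + 1}"
  have S: "S \<subseteq> {0..<2 * n}" using i j by (auto simp: S_def)
  have "inj_on c S"
  proof (rule inj_onI)
    fix u v assume uv: "u \<in> S" "v \<in> S" "c u = c v"
    then have "u < 2 * n" "v < 2 * n" using S by auto
    then have "u div 2 = v div 2" using proper uv(3) by blast
    \<comment> \<open>Only the pairs \<open>i\<close> and \<open>j\<close> lie in \<open>S\<close>
      with both vertices, and there the two colors differ.\<close>
    then show "u = v" using uv i j by (auto simp: S_def)
  qed
  then have "card S = card (c ` S)" by (simp add: card_image)
  also have "\<dots> \<le> card (c ` {0..<2 * n})" using S by (intro card_mono image_mono) auto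
  finally have "card S \<le> card (c ` {0..<2 * n})" .
  moreover have "card S = card ((\<lambda>k. 2 * k) ` {..<n}) + card {2 * i + 1, 2 * j + 1}"
    unfolding S_def
  proof (rule card_Un_disjoint)
    have "2 * k \<noteq> 2 * l + 1" for k l :: nat by presburger
    then show "(\<lambda>k. 2 * k) ` {..<n} \<inter> {2 * i + 1, 2 * j + 1} = {}" by blast
  qed simp_all
  moreover have "card ((\<lambda>k. 2 * k) ` {..<n}) = n" by (simp add: card_image inj_on_def)
  ultimately show ?thesis using j(2) by simp
qed

theorem proposition3p5:
  fixes n :: nat
  assumes "n \<ge> 2"
  shows "convex_round (cocktail_party n)
    \<and> permutation_graph (cocktail_party n)
    \<and> chromatic_number (cocktail_party n) + 2 \<le> odd_chromatic_number (cocktail_party n)"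
proof (intro conjI)
  let ?k = "odd_chromatic_number (cocktail_party n)"
  \<comment> \<open>An optimal coloring: the minimum is attained because some proper odd coloring
    with finitely many colors exists.\<close>
  obtain c :: "nat \<Rightarrow> nat" where c: "c ` pverts (cocktail_party n) \<subseteq> {..<?k}"
      "proper_odd_coloring (cocktail_party n) c"
    using LeastI_ex[OF ex_proper_odd_coloring[OF pair_graph_cocktail_party[of n]]]
    unfolding odd_chromatic_number_def by blast
  have "n + 2 \<le> card (c ` {0..<2 * n})"
    using proper_odd_coloring_cocktail_party_card c(2) assms by blast
  also have "\<dots> \<le> card {..<?k}" using c(1) by (intro card_mono) auto
  finally show "chromatic_number (cocktail_party n) + 2 \<le> ?k"
    using chromatic_number_cocktail_party_le[of n] by simp
qed (rule convex_round_cocktail_party permutation_graph_cocktail_party)+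

end
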